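(* Let $E$ and $F$ be topological graphs, let $m^1:E^1\to F^1$ and $m^0:E^0\to F^0$ be maps, and let $\widetilde{m}^i:\widetilde{E}^i\to\widetilde{F}^i$ ($i=0,1$) be the extension of $m^i$ to the one-point compactifications with $\widetilde{m}^i(\infty)=\infty$. Then the pair $(\widetilde{m}^1,\widetilde{m}^0)$ is a regular factor map from $E$ to $F$ if and only if $(m^1,m^0)$ is a regular quiver morphism from $E$ to $F$, where $E$ and $F$ are regarded as topological quivers with the counting measures on the fibres of their range maps.
   Context: All topological spaces are locally compact, Hausdorff and second countable. For a locally compact space $X$, $\widetilde{X}=X\cup\{\infty\}$ denotes its one-point compactification (with $\infty$ an isolated point if $X$ is compact). Topological graphs. A topological graph $E=(E^0,E^1,s_E,r_E)$ consists of locally compact spaces $E^0,E^1$, a local homeomorphism $r_E:E^1\to E^0$ and a continuous map $s_E:E^1\to E^0$. It is regarded as a topological quiver $(E^0,E^1,s_E,r_E,\lambda_E)$ with $\lambda_E=\{\lambda_E^v\}_{v\in E^0}$ the counting measures: for a Borel set $B\subseteq E^1$, $\lambda_E^v(B)=|B\cap r_E^{-1}(v)|$ if this is finite and $\lambda_E^v(B)=\infty$ otherwise. Topological quivers. A topological quiver $E=(E^0,E^1,s_E,r_E,\lambda_E)$ consists of second-countable locally compact Hausdorff spaces $E^0$ and $E^1$, continuous maps $s_E,r_E:E^1\to E^0$ with $r_E$ open, and a family $\lambda_E=\{\lambda_E^v\}_{v\in E^0}$ of Radon measures on $E^1$ such that $\operatorname{supp}\lambda_E^v=r_E^{-1}(v)$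 for all $v$, and for every $\xi\in C_c(E^1)$ the function $v\mapsto\int_{r_E^{-1}(v)}\xi\,d\lambda_E^v$ belongs to $C_c(E^0)$. Put $E^0_{\rm sink}=E^0\setminus\overline{s_E(E^1)}$; $E^0_{\rm fin}$ = the set of $v\in E^0$ for which there is a precompact neighborhood $V$ of $v$ such that $s_E^{-1}(\overline V)$ is compact and $r_E|_{s_E^{-1}(V)}$ is a local homeomorphism; $E^0_{\rm reg}=E^0_{\rm fin}\setminus\overline{E^0_{\rm sink}}$. Regular quiver morphisms. A quiver morphism $m=(m^1,m^0):E\to F$ consists of continuous maps $m^1:E^1\to F^1$, $m^0:E^0\to F^0$ with $s_F\circ m^1=m^0\circ s_E$ and $r_F\circ m^1=m^0\circ r_E$. It is regular if (A1) $m^1$ and $m^0$ are proper (preimages of compact sets are compact); (A2) for all $v\in E^0$, $m^1|_{r_E^{-1}(v)}$ is injective and $\lambda_F^{m^0(v)}=m^1_*(\lambda_E^v)$ (pushforward measure); (A3) $(m^0)^{-1}(F^0_{\rm reg})\subseteq E^0_{\rm reg}$. Regular factor maps. A factor map from a topological graph $E$ to a topological graph $F$ is a pair $(\widetilde{m}^1,\widetilde{m}^0)$ of continuous maps $\widetilde{m}^1:\widetilde{E}^1\to\widetilde{F}^1$ and $\widetilde{m}^0:\widetilde{E}^0\to\widetilde{F}^0$ sending $\infty$ to $\infty$ such that (F1) for every $e\in E^1$ with $\widetilde{m}^1(e)\in F^1$, one has $s_F(\widetilde{m}^1(e))=\widetilde{m}^0(s_E(e))$ and $r_F(\widetilde{m}^1(e))=\widetilde{m}^0(r_E(e))$;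 (F2) if $x\in F^1$ and $v\in E^0$ satisfy $r_F(x)=\widetilde{m}^0(v)$, then there is a unique $e\in E^1$ with $\widetilde{m}^1(e)=x$ and $r_E(e)=v$. A factor map is regular if $s_E^{-1}(v)$ is non-empty and contained in $(\widetilde{m}^1)^{-1}(F^1)$ for every $v\in E^0$ with $\widetilde{m}^0(v)\in F^0_{\rm reg}$. *)

theory Defs
  imports "HOL-Analysis.Analysis"
begin

text \<open>
  Spaces are abstract topologies (so that, for instance, the edge space of a graph may be empty).
  A map between spaces is a total HOL function of which only the restriction to the
  carrier \<^const>\<open>topspace\<close> is relevant.
\<close>

definition lch2_space :: "'a topology \<Rightarrow> bool" where
  "lch2_space X \<longleftrightarrow> locally_compact_space X \<and> Hausdorff_space X \<and> second_countable X"

definition local_homeomorphism :: "'a topology \<Rightarrow> 'b topology \<Rightarrow> ('a \<Rightarrow> 'b) \<Rightarrow> bool" where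
  "local_homeomorphism X Y f \<longleftrightarrow>
     (\<forall>x \<in> topspace X. \<exists>U. openin X U \<and> x \<in> U \<and> openin Y (f ` U) \<and>
        homeomorphic_map (subtopology X U) (subtopology Y (f ` U)) f)"

text \<open>
  Not the library's \<^const>\<open>proper_map\<close>, which asks for a closed map with compact fibres.
\<close>

definition compact_preimages :: "'a topology \<Rightarrow> 'b topology \<Rightarrow> ('a \<Rightarrow> 'b) \<Rightarrow> bool" where
  "compact_preimages X Y f \<longleftrightarrow>
     (\<forall>K. compactin Y K \<longrightarrow> compactin X {x \<in> topspace X. f x \<in> K})"

definition Cc :: "'a topology \<Rightarrow> ('a \<Rightarrow> complex) set" where
  "Cc X = {f. continuous_map X euclidean f \<and>
              compactin X (X closure_of {x \<in> topspace X. f x \<noteq> 0})}"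

definition Borel_sets :: "'a topology \<Rightarrow> 'a set set" where
  "Borel_sets X = sigma_sets (topspace X) {U. openin X U}"

definition Borel_space :: "'a topology \<Rightarrow> 'a measure" where
  "Borel_space X = sigma (topspace X) {U. openin X U}"

definition Radon_measure :: "'a topology \<Rightarrow> 'a measure \<Rightarrow> bool" where
  "Radon_measure X M \<longleftrightarrow>
     sets M = Borel_sets X \<and>
     (\<forall>K. compactin X K \<longrightarrow> emeasure M K < \<infinity>) \<and>
     (\<forall>B \<in> Borel_sets X. emeasure M B = (INF U \<in> {U. openin X U \<and> B \<subseteq> U}. emeasure M U)) \<and>
     (\<forall>U. openin X U \<longrightarrow> emeasure M U = (SUP K \<in> {K. compactin X K \<and> K \<subseteq> U}. emeasure M K))"

definition measure_support :: "'a topology \<Rightarrow> 'a measure \<Rightarrow> 'a set" where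
  "measure_support X M =
     {x \<in> topspace X. \<forall>U. openin X U \<and> x \<in> U \<longrightarrow> emeasure M U > 0}"


section \<open>Topological graphs and topological quivers\<close>

record ('v, 'e) tgraph =
  verts :: "'v topology"
  edges :: "'e topology"
  src :: "'e \<Rightarrow> 'v"
  rng :: "'e \<Rightarrow> 'v"

record ('v, 'e) tquiver = "('v, 'e) tgraph" +
  fib_measure :: "'v \<Rightarrow> 'e measure"

definition rng_fibre :: "('v, 'e, 'z) tgraph_scheme \<Rightarrow> 'v \<Rightarrow> 'e set" where
  "rng_fibre E v = {e \<in> topspace (edges E). rng E e = v}"

definition src_preimage :: "('v, 'e, 'z) tgraph_scheme \<Rightarrow> 'v set \<Rightarrow> 'e set" where
  "src_preimage E V = {e \<in> topspace (edges E). src E e \<in> V}"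

definition topological_graph :: "('v, 'e) tgraph \<Rightarrow> bool" where
  "topological_graph E \<longleftrightarrow>
     lch2_space (verts E) \<and> lch2_space (edges E) \<and>
     local_homeomorphism (edges E) (verts E) (rng E) \<and>
     continuous_map (edges E) (verts E) (src E)"

definition topological_quiver :: "('v, 'e) tquiver \<Rightarrow> bool" where
  "topological_quiver E \<longleftrightarrow>
     lch2_space (verts E) \<and> lch2_space (edges E) \<and>
     continuous_map (edges E) (verts E) (src E) \<and>
     continuous_map (edges E) (verts E) (rng E) \<and>
     open_map (edges E) (verts E) (rng E) \<and>
     (\<forall>v \<in> topspace (verts E).
        Radon_measure (edges E) (fib_measure E v) \<and>
        measure_support (edges E) (fib_measure E v) = rng_fibre E v) \<and>
     (\<forall>\<xi> \<in> Cc (edges E).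
        (\<lambda>v. set_lebesgue_integral (fib_measure E v) (rng_fibre E v) \<xi>) \<in> Cc (verts E))"

text \<open>
  The following three vertex sets do not depend on the measures, so they are defined for
  graphs and quivers at once.  A neighbourhood need not be open.
\<close>

definition sink_verts :: "('v, 'e, 'z) tgraph_scheme \<Rightarrow> 'v set" where
  "sink_verts E = topspace (verts E) - verts E closure_of (src E ` topspace (edges E))"

definition fin_verts :: "('v, 'e, 'z) tgraph_scheme \<Rightarrow> 'v set" where
  "fin_verts E = {v \<in> topspace (verts E).
     \<exists>V. V \<subseteq> topspace (verts E) \<and> v \<in> verts E interior_of V \<and>
         compactin (verts E) (verts E closure_of V) \<and>
         compactin (edges E) (src_preimage E (verts E closure_of V)) \<and>
         local_homeomorphism (subtopology (edges E) (src_preimage E V)) (verts E) (rng E)}"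

definition reg_verts :: "('v, 'e, 'z) tgraph_scheme \<Rightarrow> 'v set" where
  "reg_verts E = fin_verts E - verts E closure_of sink_verts E"


section \<open>A topological graph as a topological quiver\<close>

definition counting_measure :: "('v, 'e) tgraph \<Rightarrow> 'v \<Rightarrow> 'e measure" where
  "counting_measure E v =
     measure_of (topspace (edges E)) (Borel_sets (edges E))
       (\<lambda>B. if finite (B \<inter> rng_fibre E v) then of_nat (card (B \<inter> rng_fibre E v)) else \<infinity>)"

definition counting_quiver :: "('v, 'e) tgraph \<Rightarrow> ('v, 'e) tquiver" where
  "counting_quiver E =
     \<lparr>verts = verts E, edges = edges E, src = src E, rng = rng E,
      fib_measure = counting_measure E\<rparr>"

text \<open>
  \<^const>\<open>measure_of\<close> yields the zero measure unless the given set function is a measure;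
  the next lemma shows that this does not happen here.
\<close>

lemma sigma_algebra_Borel_sets: "sigma_algebra (topspace X) (Borel_sets X)"
  unfolding Borel_sets_def
  by (rule sigma_algebra_sigma_sets) (auto dest: openin_subset)

lemma sets_counting_measure: "sets (counting_measure E v) = Borel_sets (edges E)"
  unfolding counting_measure_def
  by (simp add: sigma_algebra.sets_measure_of_eq[OF sigma_algebra_Borel_sets])

lemma emeasure_counting_measure:
  fixes E :: "('v, 'e) tgraph"
  assumes "B \<in> Borel_sets (edges E)"
  shows "emeasure (counting_measure E v) B =
    (if finite (B \<inter> rng_fibre E v) then of_nat (card (B \<inter> rng_fibre E v)) else \<infinity>)"
proof -
  let ?f = "\<lambda>B :: 'e set. if finite (B \<inter> rng_fibre E v) then of_nat (card (B \<inter> rng_fibre E v)) else (\<infinity>::ennreal)"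
  have f: "?f B = emeasure (count_space UNIV) (B \<inter> rng_fibre E v)" for B
    by (simp add: emeasure_count_space)
  have "countably_additive (Borel_sets (edges E)) ?f"
    unfolding countably_additive_def f
  proof (intro allI impI)
    fix A :: "nat \<Rightarrow> 'e set" assume "disjoint_family A"
    then have "disjoint_family (\<lambda>i. A i \<inter> rng_fibre E v)"
      by (auto simp: disjoint_family_on_def)
    then show "(\<Sum>i. emeasure (count_space UNIV) (A i \<inter> rng_fibre E v)) =
        emeasure (count_space UNIV) (\<Union> (range A) \<inter> rng_fibre E v)"
      by (subst suminf_emeasure) (auto intro!: arg_cong2[where f=emeasure])
  qed
  then show ?thesis
    unfolding counting_measure_def
    by (intro emeasure_measure_of_sigma[OF sigma_algebra_Borel_sets _ _ assms])
       (simp_all add: positive_def)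
qed


section \<open>Morphisms\<close>

definition quiver_morphism ::
    "('v, 'e) tquiver \<Rightarrow> ('w, 'f) tquiver \<Rightarrow> ('e \<Rightarrow> 'f) \<Rightarrow> ('v \<Rightarrow> 'w) \<Rightarrow> bool" where
  "quiver_morphism E F m1 m0 \<longleftrightarrow>
     topological_quiver E \<and> topological_quiver F \<and>
     continuous_map (edges E) (edges F) m1 \<and>
     continuous_map (verts E) (verts F) m0 \<and>
     (\<forall>e \<in> topspace (edges E). src F (m1 e) = m0 (src E e) \<and> rng F (m1 e) = m0 (rng E e))"

definition regular_quiver_morphism ::
    "('v, 'e) tquiver \<Rightarrow> ('w, 'f) tquiver \<Rightarrow> ('e \<Rightarrow> 'f) \<Rightarrow> ('v \<Rightarrow> 'w) \<Rightarrow> bool" where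
  "regular_quiver_morphism E F m1 m0 \<longleftrightarrow>
     quiver_morphism E F m1 m0 \<and>
     \<comment> \<open>(A1)\<close>
     compact_preimages (edges E) (edges F) m1 \<and>
     compact_preimages (verts E) (verts F) m0 \<and>
     \<comment> \<open>(A2)\<close>
     (\<forall>v \<in> topspace (verts E).
        inj_on m1 (rng_fibre E v) \<and>
        fib_measure F (m0 v) = distr (fib_measure E v) (Borel_space (edges F)) m1) \<and>
     \<comment> \<open>(A3)\<close>
     {v \<in> topspace (verts E). m0 v \<in> reg_verts F} \<subseteq> reg_verts E"

text \<open>
  The library's \<^const>\<open>Alexandroff_compactification\<close> of \<open>X\<close> has points \<open>Some x\<close>
  and the point at infinity \<^const>\<open>None\<close>, which is isolated when \<open>X\<close> is compact.
\<close>

definition factor_map ::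
    "('v, 'e) tgraph \<Rightarrow> ('w, 'f) tgraph \<Rightarrow>
     ('e option \<Rightarrow> 'f option) \<Rightarrow> ('v option \<Rightarrow> 'w option) \<Rightarrow> bool" where
  "factor_map E F n1 n0 \<longleftrightarrow>
     topological_graph E \<and> topological_graph F \<and>
     continuous_map (Alexandroff_compactification (edges E))
                    (Alexandroff_compactification (edges F)) n1 \<and>
     continuous_map (Alexandroff_compactification (verts E))
                    (Alexandroff_compactification (verts F)) n0 \<and>
     n1 None = None \<and> n0 None = None \<and>
     \<comment> \<open>(F1)\<close>
     (\<forall>e \<in> topspace (edges E). \<forall>x \<in> topspace (edges F). n1 (Some e) = Some x \<longrightarrow>
        Some (src F x) = n0 (Some (src E e)) \<and>
        Some (rng F x) = n0 (Some (rng E e))) \<and>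
     \<comment> \<open>(F2)\<close>
     (\<forall>x \<in> topspace (edges F). \<forall>v \<in> topspace (verts E). Some (rng F x) = n0 (Some v) \<longrightarrow>
        (\<exists>!e. e \<in> topspace (edges E) \<and> n1 (Some e) = Some x \<and> rng E e = v))"

definition regular_factor_map ::
    "('v, 'e) tgraph \<Rightarrow> ('w, 'f) tgraph \<Rightarrow>
     ('e option \<Rightarrow> 'f option) \<Rightarrow> ('v option \<Rightarrow> 'w option) \<Rightarrow> bool" where
  "regular_factor_map E F n1 n0 \<longleftrightarrow>
     factor_map E F n1 n0 \<and>
     (\<forall>v \<in> topspace (verts E). n0 (Some v) \<in> Some ` reg_verts F \<longrightarrow>
        src_preimage E {v} \<noteq> {} \<and>
        (\<forall>e \<in> src_preimage E {v}. n1 (Some e) \<in> Some ` topspace (edges F)))"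

end

theory Submission
  imports Defs
begin

text \<open>
  The two notions match condition by condition.  A map between locally compact Hausdorff spaces
  extends continuously to the one-point compactifications by \<open>\<infinity> \<mapsto> \<infinity>\<close> iff it is continuous and
  proper.  Given that the pair commutes with source and range, unique lifting of edges says that
  \<open>m1\<close> maps each range fibre bijectively onto a range fibre; testing on singletons shows
  that this is the same as injectivity together with the pushforward identity for the counting
  measures.  Finally, a regular vertex emits an edge, and conversely regularity of
  \<open>m0 v\<close> is pulled back to \<open>v\<close> along the proper maps once every vertex over
  \<open>reg_verts F\<close> emits an edge.  That a graph is a quiver comes down to the fibres of a local
  homeomorphism being closed and discrete, and to summation over them preserving continuity and
  compact support.
\<close>

section \<open>Local homeomorphisms\<close>

text \<open>The pasting lemma for a constant family: all local pieces are the same \<open>f\<close>,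
  so they agree on overlaps.\<close>

lemma continuous_map_locally:
  assumes "\<And>x. x \<in> topspace X \<Longrightarrow>
    \<exists>T. openin X T \<and> x \<in> T \<and> continuous_map (subtopology X T) Y f"
  shows "continuous_map X Y f"
  by (rule pasting_lemma[of "{T. openin X T \<and> continuous_map (subtopology X T) Y f}" X "\<lambda>T. T"
        Y "\<lambda>_. f"]) (use assms in auto)

lemma local_homeomorphismE:
  assumes "local_homeomorphism X Y f" "x \<in> topspace X"
  obtains U where "openin X U" "x \<in> U" "openin Y (f ` U)"
    "homeomorphic_map (subtopology X U) (subtopology Y (f ` U)) f" "inj_on f U"
proof -
  obtain U where U: "openin X U" "x \<in> U" "openin Y (f ` U)"
      "homeomorphic_map (subtopology X U) (subtopology Y (f ` U)) f"
    using assms unfolding local_homeomorphism_def by blast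
  have "inj_on f U"
    using homeomorphic_imp_injective_map[OF U(4)] openin_subset[OF U(1)] by (simp add: Int_absorb1)
  with U that show thesis by blast
qed

text \<open>Charts of a local homeomorphism can be shrunk: \<open>f\<close>
  V\<open>is open in\<close>f \<open>U\<close>, which is itself open in \<open>Y\<close>. This lets
  a chart be intersected with any prescribed open set.\<close>

lemma homeomorphic_map_restrict_open:
  assumes "homeomorphic_map (subtopology X U) (subtopology Y (f ` U)) f"
    and "openin X U" "openin Y (f ` U)" "openin X V" "V \<subseteq> U"
  shows "openin Y (f ` V)" "homeomorphic_map (subtopology X V) (subtopology Y (f ` V)) f"
proof -
  have "openin (subtopology X U) V"
    using assms by (simp add: openin_open_subtopology)
  then have "openin (subtopology Y (f ` U)) (f ` V)"
    using assms(1) homeomorphic_imp_open_map open_map_def by blast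
  then show "openin Y (f ` V)"
    using assms(3) openin_trans_full by blast
  have "U \<subseteq> topspace X" "f ` U \<subseteq> topspace Y"
    using assms(2,3) openin_subset by auto
  moreover have "inj_on f U"
    using homeomorphic_imp_injective_map[OF assms(1)] \<open>U \<subseteq> topspace X\<close> by (simp add: Int_absorb1)
  ultimately have "homeomorphic_map (subtopology (subtopology X U) V) (subtopology (subtopology Y (f ` U)) (f ` V)) f"
    using assms(5)
    by (intro homeomorphic_map_subtopologies[OF assms(1)])
       (simp add: Int_absorb1 Int_absorb2 image_mono)
  moreover have "U \<inter> V = V" "f ` U \<inter> f ` V = f ` V"
    using assms(5) by auto
  ultimately show "homeomorphic_map (subtopology X V) (subtopology Y (f ` V)) f"
    by (simp add: subtopology_subtopology)
qed

lemma local_homeomorphism_continuous_map: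
  assumes "local_homeomorphism X Y f"
  shows "continuous_map X Y f"
proof (rule continuous_map_locally)
  fix x assume "x \<in> topspace X"
  then show "\<exists>T. openin X T \<and> x \<in> T \<and> continuous_map (subtopology X T) Y f"
    using local_homeomorphismE[OF assms] homeomorphic_imp_continuous_map
      continuous_map_into_fulltopology by metis
qed

lemma local_homeomorphism_open_map:
  assumes "local_homeomorphism X Y f"
  shows "open_map X Y f"
  unfolding open_map_def
proof (intro allI impI)
  fix V assume V: "openin X V"
  show "openin Y (f ` V)"
  proof (subst openin_subopen, intro ballI)
    fix y assume "y \<in> f ` V"
    then obtain x where x: "x \<in> V" "y = f x" by blast
    then obtain U where U: "openin X U" "x \<in> U" "openin Y (f ` U)"
        "homeomorphic_map (subtopology X U) (subtopology Y (f ` U)) f"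
      using local_homeomorphismE[OF assms] openin_subset[OF V] by (metis subsetD)
    have "openin Y (f ` (U \<inter> V))"
      using homeomorphic_map_restrict_open(1)[OF U(4,1,3)] U(1) V by auto
    then show "\<exists>T. openin Y T \<and> y \<in> T \<and> T \<subseteq> f ` V"
      using x U(2) by (intro exI[of _ "f ` (U \<inter> V)"]) auto
  qed
qed

lemma local_homeomorphism_open_subtopology:
  assumes "local_homeomorphism X Y f" "openin X V"
  shows "local_homeomorphism (subtopology X V) Y f"
  unfolding local_homeomorphism_def
proof
  fix x assume "x \<in> topspace (subtopology X V)"
  then have x: "x \<in> topspace X" "x \<in> V" by auto
  obtain U where U: "openin X U" "x \<in> U" "openin Y (f ` U)"
      "homeomorphic_map (subtopology X U) (subtopology Y (f ` U)) f"
    using local_homeomorphismE[OF assms(1) x(1)] by metis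
  have UV: "openin X (U \<inter> V)" using U assms(2) by blast
  have "V \<inter> (U \<inter> V) = U \<inter> V" by blast
  then show "\<exists>W. openin (subtopology X V) W \<and> x \<in> W \<and> openin Y (f ` W) \<and>
      homeomorphic_map (subtopology (subtopology X V) W) (subtopology Y (f ` W)) f"
    using homeomorphic_map_restrict_open[OF U(4,1,3) UV] x U(2) UV assms(2)
    by (intro exI[of _ "U \<inter> V"]) (auto simp: openin_open_subtopology subtopology_subtopology)
qed

section \<open>Fibres of local homeomorphisms are closed and discrete\<close>

text \<open>A chart around a fibre point is injective and so contains no second fibre point; a point
  off the fibre is separated from it by the preimage of the complement of \<open>v\<close>. Allowing
  every subset \<open>S\<close> of the fibre expresses closedness and discreteness at once.\<close>

lemma closedin_fibre_subset:
  assumes f: "local_homeomorphism X Y f" and Y: "Hausdorff_space Y"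
    and S: "S \<subseteq> {x \<in> topspace X. f x = v}"
  shows "closedin X S"
  unfolding closedin_def
proof
  show "S \<subseteq> topspace X" using S by blast
  have cont: "continuous_map X Y f"
    using f by (rule local_homeomorphism_continuous_map)
  show "openin X (topspace X - S)"
  proof (subst openin_subopen, intro ballI)
    fix x assume x: "x \<in> topspace X - S"
    show "\<exists>T. openin X T \<and> x \<in> T \<and> T \<subseteq> topspace X - S"
    proof (cases "f x = v")
      case True
      obtain U where U: "openin X U" "x \<in> U" "inj_on f U"
        using local_homeomorphismE[OF f] x by (metis DiffD1)
      have "U \<inter> S = {}"
        using U(2,3) x S True by (auto dest: inj_onD)
      then show ?thesis
        using U openin_subset[OF U(1)] by blast
    next
      case False
      have "f x \<in> topspace Y"
        using x cont by (auto simp: continuous_map_def)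
      then have "openin Y (topspace Y - {v})"
        using open_in_Hausdorff_delete[OF Y] by blast
      then have "openin X {x \<in> topspace X. f x \<in> topspace Y - {v}}"
        using cont openin_continuous_map_preimage by blast
      then show ?thesis
        using S x False \<open>f x \<in> topspace Y\<close>
        by (intro exI[of _ "{x \<in> topspace X. f x \<in> topspace Y - {v}}"]) auto
    qed
  qed
qed

text \<open>An infinite part of the fibre inside \<open>K\<close> would have a limit point
  \<open>x\<close>. Removing \<open>x\<close> leaves a subset of the fibre, hence a closed set, and
  its complement is a neighbourhood of \<open>x\<close> that meets the part in at most
  \<open>x\<close> itself.\<close>

lemma finite_compact_Int_fibre:
  assumes "local_homeomorphism X Y f" "Hausdorff_space Y" "compactin X K"
  shows "finite (K \<inter> {x \<in> topspace X. f x = v})"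
proof (rule ccontr)
  let ?T = "K \<inter> {x \<in> topspace X. f x = v}"
  assume "infinite ?T"
  then obtain x where x: "x \<in> X derived_set_of ?T"
    using compactin_imp_Bolzano_Weierstrass[OF assms(3), of ?T] by auto
  have "closedin X (?T - {x})"
    by (rule closedin_fibre_subset[OF assms(1,2), where v = v]) auto
  then have "openin X (topspace X - (?T - {x}))" by blast
  moreover have "x \<in> topspace X - (?T - {x})"
    using x by (simp add: in_derived_set_of)
  ultimately have "\<exists>y\<noteq>x. y \<in> ?T \<and> y \<in> topspace X - (?T - {x})"
    using x by (simp only: in_derived_set_of)
  then show False by blast
qed

section \<open>Sums over the fibres\<close>

lemma Hausdorff_finite_disjoint_neighbourhoods:
  assumes X: "Hausdorff_space X" and S: "finite S" "S \<subseteq> topspace X"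
  obtains U where "\<And>s. s \<in> S \<Longrightarrow> openin X (U s) \<and> s \<in> U s" "disjoint_family_on U S"
proof -
  have "\<exists>A B. openin X A \<and> openin X B \<and> s \<in> A \<and> t \<in> B \<and> disjnt A B"
    if "s \<in> S" "t \<in> S" "s \<noteq> t" for s t
    using X S that unfolding Hausdorff_space_def by blast
  then obtain A B where AB: "\<And>s t. \<lbrakk>s \<in> S; t \<in> S; s \<noteq> t\<rbrakk> \<Longrightarrow>
      openin X (A s t) \<and> openin X (B s t) \<and> s \<in> A s t \<and> t \<in> B s t \<and> disjnt (A s t) (B s t)"
    by metis
  \<comment> \<open>The pairs chosen for \<open>(s, t)\<close> and for \<open>(t, s)\<close> are
    unrelated, so \<open>U s\<close> is cut down by both: then \<open>U s\<close> lies in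
    \<open>A s t\<close> and \<open>U t\<close> in \<open>B s t\<close>, which are disjoint. The
    factor \<open>topspace X\<close> takes care of a singleton \<open>S\<close>, where the
    intersection is over the empty family.\<close>
  define U where "U = (\<lambda>s. topspace X \<inter> \<Inter> ((\<lambda>t. A s t \<inter> B t s) ` (S - {s})))"
  show thesis
  proof
    fix s assume "s \<in> S"
    then show "openin X (U s) \<and> s \<in> U s"
      unfolding U_def using AB S
      by (auto intro!: openin_Int_Inter)
  next
    show "disjoint_family_on U S"
      unfolding disjoint_family_on_def U_def using AB by (fastforce simp: disjnt_def)
  qed
qed

text \<open>Near \<open>v\<close> the sum is a finite sum of continuous functions
  \<open>\<xi> \<circ> g s\<close>, with one local inverse \<open>g s\<close> of \<open>f\<close>
  for each of the finitely many fibre points \<open>s\<close> in \<open>K\<close>. Summing over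
  \<open>K\<close> only keeps the sums finite and loses nothing, since \<open>\<xi>\<close> vanishes
  elsewhere.\<close>

lemma fibre_sum_continuous:
  fixes \<xi> :: "'a \<Rightarrow> complex"
  assumes f: "local_homeomorphism X Y f" and X: "Hausdorff_space X" and Y: "Hausdorff_space Y"
    and \<xi>: "continuous_map X euclidean \<xi>" and K: "compactin X K"
    and outside: "\<And>x. \<lbrakk>x \<in> topspace X; x \<notin> K\<rbrakk> \<Longrightarrow> \<xi> x = 0"
  shows "continuous_map Y euclidean (\<lambda>v. \<Sum>x\<in>K \<inter> {x \<in> topspace X. f x = v}. \<xi> x)"
proof (rule continuous_map_locally)
  let ?h = "\<lambda>v. \<Sum>x\<in>K \<inter> {x \<in> topspace X. f x = v}. \<xi> x"
  fix v assume v: "v \<in> topspace Y"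
  define S where "S = K \<inter> {x \<in> topspace X. f x = v}"
  have S: "finite S" "S \<subseteq> topspace X"
    unfolding S_def using finite_compact_Int_fibre[OF f Y K] by auto
  have cont: "continuous_map X Y f"
    using f by (rule local_homeomorphism_continuous_map)
  obtain D where D: "\<And>s. s \<in> S \<Longrightarrow> openin X (D s) \<and> s \<in> D s" "disjoint_family_on D S"
    using Hausdorff_finite_disjoint_neighbourhoods[OF X S] by metis
  \<comment> \<open>Charts around the points of \<open>S\<close> are shrunk into the disjoint sets
    \<open>D s\<close>, so that distinct local inverses take distinct values.\<close>
  have "\<exists>U g. openin X U \<and> s \<in> U \<and> U \<subseteq> D s \<and> openin Y (f ` U) \<and>
      homeomorphic_maps (subtopology X U) (subtopology Y (f ` U)) f g" if s: "s \<in> S" for s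
  proof -
    have "s \<in> topspace X" using s S by blast
    from local_homeomorphismE[OF f this] obtain U where U: "openin X U" "s \<in> U" "openin Y (f ` U)"
        "homeomorphic_map (subtopology X U) (subtopology Y (f ` U)) f"
      by metis
    have UD: "openin X (U \<inter> D s)" "U \<inter> D s \<subseteq> U" using U D s by auto
    show ?thesis
      using homeomorphic_map_restrict_open[OF U(4,1,3) UD] UD U D s
      by (intro exI[of _ "U \<inter> D s"]) (auto simp: homeomorphic_map_maps)
  qed
  then obtain U g where U: "\<And>s. s \<in> S \<Longrightarrow> openin X (U s) \<and> s \<in> U s \<and> U s \<subseteq> D s \<and> openin Y (f ` U s) \<and>
      homeomorphic_maps (subtopology X (U s)) (subtopology Y (f ` U s)) f (g s)"
    by metis
  have UX: "U s \<subseteq> topspace X" "f ` U s \<subseteq> topspace Y" if "s \<in> S" for s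
    using U[OF that] openin_subset by auto
  have gf: "g s (f x) = x" if "s \<in> S" "x \<in> U s" for s x
    using U[OF that(1)] UX[OF that(1)] that(2) by (auto simp: homeomorphic_maps_def)
  \<comment> \<open>The part of \<open>K\<close> missed by the charts is compact, so its image is
    closed; the image avoids \<open>v\<close> because all points of \<open>K\<close> over
    \<open>v\<close> lie in \<open>S\<close>. Removing it from \<open>W\<close> below ensures that
    over \<open>W\<close> every fibre point in \<open>K\<close> lies in some chart.\<close>
  define R where "R = K - (\<Union>s\<in>S. U s)"
  have "openin X (\<Union>s\<in>S. U s)" using U by blast
  then have "compactin X R"
    using compact_Int_closedin[OF K, of "topspace X - (\<Union>s\<in>S. U s)"]
      compactin_subset_topspace[OF K]
    by (simp add: R_def Diff_eq[symmetric] Int_Diff[symmetric] Int_absorb2 openin_closedin_eq)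
  then have R: "closedin Y (f ` R)"
    using cont Y image_compactin compactin_imp_closedin by blast
  define W where "W = (topspace Y \<inter> \<Inter> ((\<lambda>s. f ` U s) ` S)) - f ` R"
  have W: "openin Y W"
    unfolding W_def using R U S by (intro openin_diff openin_Int_Inter) auto
  have RS: "x \<in> topspace X" if "x \<in> R" for x
    using that compactin_subset_topspace[OF K] by (auto simp: R_def)
  have "v \<notin> f ` R"
  proof
    assume "v \<in> f ` R"
    then obtain x where x: "x \<in> R" "f x = v" by blast
    then have "x \<in> S" using RS[OF x(1)] unfolding S_def R_def by blast
    then show False using U[of x] x(1) unfolding R_def by blast
  qed
  moreover have "v \<in> f ` U s" if s: "s \<in> S" for s
  proof -
    have "f s = v" using s by (simp add: S_def)
    then show ?thesis using U[OF s] by blast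
  qed
  ultimately have "v \<in> W"
    unfolding W_def using v by blast
  \<comment> \<open>The points \<open>g s w\<close> are distinct and exhaust the fibre points in
    \<open>K\<close> over \<open>w\<close>. Some of them may lie outside \<open>K\<close>, but there
    \<open>\<xi>\<close> is zero.\<close>
  have h: "(\<Sum>s\<in>S. \<xi> (g s w)) = ?h w" if w: "w \<in> W" for w
  proof -
    have g: "g s w \<in> U s" "f (g s w) = w" if s: "s \<in> S" for s
    proof -
      obtain x where x: "x \<in> U s" "w = f x"
        using w s unfolding W_def by blast
      then show "g s w \<in> U s" "f (g s w) = w"
        using gf[OF s x(1)] by auto
    qed
    have "inj_on (\<lambda>s. g s w) S"
    proof (rule inj_onI, rule ccontr)
      fix s t assume st: "s \<in> S" "t \<in> S" "g s w = g t w" "s \<noteq> t"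
      then have "g s w \<in> D s \<inter> D t"
        using g(1)[OF st(1)] g(1)[OF st(2)] U by auto
      then show False
        using D(2) st by (auto simp: disjoint_family_on_def)
    qed
    then have "(\<Sum>s\<in>S. \<xi> (g s w)) = (\<Sum>x\<in>(\<lambda>s. g s w) ` S. \<xi> x)"
      by (simp add: sum.reindex)
    also have "\<dots> = ?h w"
    proof (rule sum.mono_neutral_right)
      show "K \<inter> {x \<in> topspace X. f x = w} \<subseteq> (\<lambda>s. g s w) ` S"
      proof
        fix x assume x: "x \<in> K \<inter> {x \<in> topspace X. f x = w}"
        then have "x \<notin> R" using w unfolding W_def by blast
        then obtain s where "s \<in> S" "x \<in> U s" using x by (auto simp: R_def)
        then show "x \<in> (\<lambda>s. g s w) ` S" using gf x by force
      qed
      show "\<forall>x\<in>(\<lambda>s. g s w) ` S - K \<inter> {x \<in> topspace X. f x = w}. \<xi> x = 0"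
        using g UX outside by blast
    qed (use S in auto)
    finally show ?thesis .
  qed
  have "continuous_map (subtopology Y W) euclidean (\<lambda>w. \<xi> (g s w))" if s: "s \<in> S" for s
  proof -
    have "continuous_map (subtopology Y (f ` U s)) X (g s)"
      using U[OF s] by (auto simp: homeomorphic_maps_def intro: continuous_map_into_fulltopology)
    then have "continuous_map (subtopology Y (f ` U s)) euclidean (\<xi> \<circ> g s)"
      using \<xi> continuous_map_compose by blast
    then show ?thesis
      unfolding comp_def
      by (rule continuous_map_from_subtopology_mono) (use s in \<open>auto simp: W_def\<close>)
  qed
  then have "continuous_map (subtopology Y W) euclidean (\<lambda>w. \<Sum>s\<in>S. \<xi> (g s w))"
    using S(1) by (intro continuous_map_sum) auto
  then have "continuous_map (subtopology Y W) euclidean ?h"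
    by (rule continuous_map_eq) (use h in auto)
  then show "\<exists>T. openin Y T \<and> v \<in> T \<and> continuous_map (subtopology Y T) euclidean ?h"
    using W \<open>v \<in> W\<close> by blast
qed

section \<open>The quiver of a topological graph\<close>

lemma openin_imp_Borel: "openin X U \<Longrightarrow> U \<in> Borel_sets X"
  unfolding Borel_sets_def by blast

lemma closedin_imp_Borel:
  assumes "closedin X C"
  shows "C \<in> Borel_sets X"
proof -
  have "topspace X - (topspace X - C) \<in> Borel_sets X"
    unfolding Borel_sets_def
    by (rule sigma_sets.Compl) (use assms in auto)
  then show ?thesis
    using closedin_subset[OF assms] by (simp add: double_diff)
qed

lemma topological_graphD:
  assumes "topological_graph E"
  shows "Hausdorff_space (verts E)" "Hausdorff_space (edges E)"
    "local_homeomorphism (edges E) (verts E) (rng E)"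
    "continuous_map (edges E) (verts E) (src E)"
  using assms by (auto simp: topological_graph_def lch2_space_def)

lemma graph_fibre_closed:
  assumes "topological_graph E" "S \<subseteq> rng_fibre E v"
  shows "closedin (edges E) S"
  using closedin_fibre_subset[OF topological_graphD(3,1)[OF assms(1)] assms(2)[unfolded rng_fibre_def]] .

lemma graph_fibre_compact_finite:
  assumes "topological_graph E" "compactin (edges E) K"
  shows "finite (K \<inter> rng_fibre E v)"
  unfolding rng_fibre_def
  by (rule finite_compact_Int_fibre[OF topological_graphD(3,1)[OF assms(1)] assms(2)])

text \<open>Only the trace of a set on the fibre is measured, and the fibre is closed and discrete:
  compact sets have finite trace, and finite subsets of the fibre are compact.\<close>

lemma Radon_counting_measure:
  assumes E: "topological_graph E"
  shows "Radon_measure (edges E) (counting_measure E v)"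
  unfolding Radon_measure_def
proof (intro conjI allI impI ballI)
  let ?X = "edges E" and ?M = "counting_measure E v" and ?R = "rng_fibre E v"
  show "sets ?M = Borel_sets ?X" by (rule sets_counting_measure)
  note em = emeasure_counting_measure[of _ E v]
  show "emeasure ?M K < \<infinity>" if K: "compactin ?X K" for K
    using em[OF closedin_imp_Borel[OF compactin_imp_closedin[OF topological_graphD(2)[OF E] K]]]
      graph_fibre_compact_finite[OF E K, of v]
    by (simp add: of_nat_less_top)
  show "emeasure ?M B = (INF U \<in> {U. openin ?X U \<and> B \<subseteq> U}. emeasure ?M U)"
    if B: "B \<in> Borel_sets ?X" for B
  proof (rule antisym)
    show "emeasure ?M B \<le> (INF U \<in> {U. openin ?X U \<and> B \<subseteq> U}. emeasure ?M U)"
      by (rule INF_greatest, rule emeasure_mono)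
         (auto simp: sets_counting_measure openin_imp_Borel)
    \<comment> \<open>The largest set with the same trace on the fibre as \<open>B\<close>. It is
      open because every subset of the fibre is closed, so the infimum is attained.\<close>
    define U where "U = topspace ?X - (?R - B)"
    have BX: "B \<subseteq> topspace ?X"
      using B sigma_sets_into_sp[of "{U. openin ?X U}" "topspace ?X" B]
      by (auto simp: Borel_sets_def dest: openin_subset)
    have U: "openin ?X U" "B \<subseteq> U"
      unfolding U_def using graph_fibre_closed[OF E, of "?R - B" v] BX by auto
    have "U \<inter> ?R = B \<inter> ?R" using BX by (auto simp: U_def rng_fibre_def)
    then have "emeasure ?M U = emeasure ?M B"
      using em[OF B] em[OF openin_imp_Borel[OF U(1)]] by simp
    then show "(INF U \<in> {U. openin ?X U \<and> B \<subseteq> U}. emeasure ?M U) \<le> emeasure ?M B"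
      using U by (metis (mono_tags, lifting) INF_lower mem_Collect_eq)
  qed
  show "emeasure ?M U = (SUP K \<in> {K. compactin ?X K \<and> K \<subseteq> U}. emeasure ?M K)"
    if U: "openin ?X U" for U
  proof (rule antisym)
    show "(SUP K \<in> {K. compactin ?X K \<and> K \<subseteq> U}. emeasure ?M K) \<le> emeasure ?M U"
      by (rule SUP_least, rule emeasure_mono)
         (auto simp: sets_counting_measure openin_imp_Borel U)
    \<comment> \<open>Finite subsets of the trace are compact test sets. If the trace is finite, it
      is itself such a set; otherwise there are such sets of every cardinality, which forces the
      supremum to be infinite.\<close>
    have fin: "of_nat (card S) \<le> (SUP K \<in> {K. compactin ?X K \<and> K \<subseteq> U}. emeasure ?M K)"
      if S: "finite S" "S \<subseteq> U \<inter> ?R" for S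
    proof -
      have c: "compactin ?X S"
        using S by (intro finite_imp_compactin) (auto simp: rng_fibre_def)
      have "S \<inter> ?R = S" using S by blast
      then have "emeasure ?M S = of_nat (card S)"
        using em[OF closedin_imp_Borel[OF graph_fibre_closed[OF E, of S]]] S by auto
      then show ?thesis
        using c S by (metis (mono_tags, lifting) SUP_upper mem_Collect_eq le_inf_iff)
    qed
    show "emeasure ?M U \<le> (SUP K \<in> {K. compactin ?X K \<and> K \<subseteq> U}. emeasure ?M K)"
    proof (cases "finite (U \<inter> ?R)")
      case True
      then show ?thesis
        using fin[of "U \<inter> ?R"] em[OF openin_imp_Borel[OF U]] by simp
    next
      case False
      have "of_nat n \<le> (SUP K \<in> {K. compactin ?X K \<and> K \<subseteq> U}. emeasure ?M K)" for n
        using infinite_arbitrarily_large[OF False, of n] fin by metis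
      then have "(SUP n. of_nat n) \<le> (SUP K \<in> {K. compactin ?X K \<and> K \<subseteq> U}. emeasure ?M K)"
        by (rule SUP_least)
      then show ?thesis
        unfolding ennreal_SUP_of_nat_eq_top using order_trans[OF top_greatest] by blast
    qed
  qed
qed

text \<open>An open set has positive measure exactly when it meets the fibre, and since the fibre is
  closed, points off it have a null neighbourhood.\<close>

lemma support_counting_measure:
  assumes E: "topological_graph E"
  shows "measure_support (edges E) (counting_measure E v) = rng_fibre E v"
proof -
  let ?X = "edges E" and ?M = "counting_measure E v" and ?R = "rng_fibre E v"
  have pos: "emeasure ?M U > 0 \<longleftrightarrow> U \<inter> ?R \<noteq> {}" if "openin ?X U" for U
    using emeasure_counting_measure[OF openin_imp_Borel[OF that], of v] 
    by (auto simp: card_gt_0_iff zero_less_iff_neq_zero)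
  have "openin ?X (topspace ?X - ?R)"
    using graph_fibre_closed[OF E] by blast
  moreover have "?R \<subseteq> topspace ?X" by (auto simp: rng_fibre_def)
  ultimately show ?thesis
    unfolding measure_support_def using pos by fastforce
qed

text \<open>On the fibre \<open>\<xi>\<close> lives on the finite set \<open>S\<close>, whose points
  are atoms of mass 1; the integrand is therefore a finite combination of indicators of
  singletons.\<close>

lemma integral_counting_measure:
  assumes E: "topological_graph E" and S: "finite S" "S \<subseteq> rng_fibre E v"
    and \<xi>: "\<And>e. e \<in> rng_fibre E v - S \<Longrightarrow> \<xi> e = (0::complex)"
  shows "set_lebesgue_integral (counting_measure E v) (rng_fibre E v) \<xi> = sum \<xi> S"
proof -
  let ?M = "counting_measure E v"
  have sing: "has_bochner_integral ?M (\<lambda>x. indicator {e} x *\<^sub>R \<xi> e) (\<xi> e)" if e: "e \<in> S" for e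
  proof -
    have B: "{e} \<in> Borel_sets (edges E)"
      using graph_fibre_closed[OF E, of "{e}" v] S e closedin_imp_Borel by blast
    have "{e} \<inter> rng_fibre E v = {e}" using e S by blast
    then have "emeasure ?M {e} = 1"
      using emeasure_counting_measure[OF B, of v] by simp
    then have "measure ?M {e} = 1" "emeasure ?M {e} < \<infinity>" by (auto simp: measure_def)
    then show ?thesis
      using has_bochner_integral_indicator[of "{e}" ?M "\<xi> e"] B by (simp add: sets_counting_measure)
  qed
  have "indicator (rng_fibre E v) x *\<^sub>R \<xi> x = (\<Sum>e\<in>S. indicator {e} x *\<^sub>R \<xi> e)" for x
  proof -
    have "(\<Sum>e\<in>S. indicator {e} x *\<^sub>R \<xi> e) = (\<Sum>e\<in>S. if x = e then \<xi> e else 0)"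
      by (rule sum.cong) (auto simp: indicator_def)
    also have "\<dots> = (if x \<in> S then \<xi> x else 0)" using S(1) by simp
    finally show ?thesis using S \<xi> by (auto simp: indicator_def)
  qed
  then show ?thesis
    unfolding set_lebesgue_integral_def
    using has_bochner_integral_integral_eq[OF has_bochner_integral_sum[OF sing]] by simp
qed

lemma topological_quiver_counting_quiver:
  fixes E :: "('v, 'e) tgraph"
  assumes E: "topological_graph E"
  shows "topological_quiver (counting_quiver E)"
proof -
  have sel: "verts (counting_quiver E) = verts E" "edges (counting_quiver E) = edges E"
    "src (counting_quiver E) = src E" "rng (counting_quiver E) = rng E"
    "fib_measure (counting_quiver E) = counting_measure E"
    "rng_fibre (counting_quiver E) = rng_fibre E"
    by (auto simp: counting_quiver_def rng_fibre_def fun_eq_iff)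
  note lh = topological_graphD(3)[OF E]
  have "(\<lambda>v. set_lebesgue_integral (counting_measure E v) (rng_fibre E v) \<xi>) \<in> Cc (verts E)"
    if \<xi>: "\<xi> \<in> Cc (edges E)" for \<xi>
  proof -
    define K where "K = edges E closure_of {x \<in> topspace (edges E). \<xi> x \<noteq> 0}"
    define h where "h = (\<lambda>v. \<Sum>e\<in>K \<inter> {e \<in> topspace (edges E). rng E e = v}. \<xi> e)"
    have cont: "continuous_map (edges E) euclidean \<xi>" and K: "compactin (edges E) K"
      using \<xi> by (auto simp: Cc_def K_def)
    have "{x \<in> topspace (edges E). \<xi> x \<noteq> 0} \<subseteq> K"
      unfolding K_def by (rule closure_of_subset) auto
    then have out: "\<xi> e = 0" if "e \<in> topspace (edges E)" "e \<notin> K" for e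
      using that by blast
    have int: "set_lebesgue_integral (counting_measure E v) (rng_fibre E v) \<xi> = h v" for v
      unfolding h_def using graph_fibre_compact_finite[OF E K, of v] out
      by (intro integral_counting_measure[OF E]) (auto simp: rng_fibre_def)
    have h: "continuous_map (verts E) euclidean h"
      unfolding h_def
      by (rule fibre_sum_continuous[OF lh topological_graphD(2,1)[OF E] cont K out])
    have rK: "compactin (verts E) (rng E ` K)"
      using K local_homeomorphism_continuous_map[OF lh] image_compactin by blast
    have "{v \<in> topspace (verts E). h v \<noteq> 0} \<subseteq> rng E ` K"
    proof clarify
      fix v assume "h v \<noteq> 0"
      then have "K \<inter> {e \<in> topspace (edges E). rng E e = v} \<noteq> {}"
        unfolding h_def by (metis sum.empty)
      then show "v \<in> rng E ` K" by blast
    qed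
    then have "verts E closure_of {v \<in> topspace (verts E). h v \<noteq> 0} \<subseteq> rng E ` K"
      using compactin_imp_closedin[OF topological_graphD(1)[OF E] rK] by (rule closure_of_minimal)
    then have "compactin (verts E) (verts E closure_of {v \<in> topspace (verts E). h v \<noteq> 0})"
      by (rule closed_compactin[OF rK _ closedin_closure_of])
    then show ?thesis using h by (simp add: Cc_def int)
  qed
  then show ?thesis
    using E Radon_counting_measure[OF E] support_counting_measure[OF E]
      local_homeomorphism_continuous_map[OF lh] local_homeomorphism_open_map[OF lh]
    by (simp add: topological_quiver_def sel topological_graph_def)
qed

section \<open>Continuity, lifting and regularity\<close>

text \<open>Since \<open>map_option f\<close> sends only \<open>None\<close> to \<open>None\<close>,
  preimages of sets of finite points consist of finite points. Pulling back open sets of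
  \<open>Y\<close> then gives continuity, and pulling back compact sets, which are closed in the
  compactification, gives properness.\<close>

lemma continuous_map_Alexandroff_compactification_iff:
  assumes Y: "Hausdorff_space Y" and f: "f \<in> topspace X \<rightarrow> topspace Y"
  shows "continuous_map (Alexandroff_compactification X) (Alexandroff_compactification Y) (map_option f)
    \<longleftrightarrow> continuous_map X Y f \<and> compact_preimages X Y f"
    (is "?L \<longleftrightarrow> ?R")
proof
  let ?X = "Alexandroff_compactification X" and ?Y = "Alexandroff_compactification Y"
  assume L: ?L
  have "openin X {x \<in> topspace X. f x \<in> U}" if U: "openin Y U" for U
  proof -
    have "{z \<in> topspace ?X. map_option f z \<in> Some ` U} = Some ` {x \<in> topspace X. f x \<in> U}"
      by auto
    moreover have "openin ?X {z \<in> topspace ?X. map_option f z \<in> Some ` U}"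
      using U by (intro openin_continuous_map_preimage[OF L]) simp
    ultimately show ?thesis by simp
  qed
  moreover have "compactin X {x \<in> topspace X. f x \<in> K}" if K: "compactin Y K" for K
  proof -
    have "{z \<in> topspace ?X. map_option f z \<in> Some ` K} = Some ` {x \<in> topspace X. f x \<in> K}"
      by auto
    moreover have "closedin ?X {z \<in> topspace ?X. map_option f z \<in> Some ` K}"
      using K compactin_imp_closedin[OF Y K] by (intro closedin_continuous_map_preimage[OF L]) simp
    ultimately show ?thesis by simp
  qed
  ultimately show ?R
    using f by (auto simp: continuous_map_def compact_preimages_def)
next
  let ?X = "Alexandroff_compactification X" and ?Y = "Alexandroff_compactification Y"
  assume R: ?R
  \<comment> \<open>A closed set of the compactification of \<open>Y\<close> is either a closed
    compact set of \<open>Y\<close>, handled by properness, or the complement of an open set of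
    \<open>Y\<close>, handled by continuity.\<close>
  have "closedin ?X {z \<in> topspace ?X. map_option f z \<in> C}" if "closedin ?Y C" for C
    using that unfolding closedin_Alexandroff_compactification[of Y]
  proof (elim disjE exE conjE)
    fix K assume K: "compactin Y K" "closedin Y K" "C = Some ` K"
    then have "{z \<in> topspace ?X. map_option f z \<in> C} = Some ` {x \<in> topspace X. f x \<in> K}"
      by auto
    then show ?thesis
      using R K closedin_continuous_map_preimage[of X Y f K]
      by (simp add: compact_preimages_def del: topspace_Alexandroff_compactification)
  next
    fix U assume U: "openin Y U" "C = topspace ?Y - Some ` U"
    then have "{z \<in> topspace ?X. map_option f z \<in> C} = topspace ?X - Some ` {x \<in> topspace X. f x \<in> U}"
      using f by auto
    moreover have "openin ?X (Some ` {x \<in> topspace X. f x \<in> U})"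
      using R U openin_continuous_map_preimage by fastforce
    ultimately show ?thesis by (simp only: closedin_diff closedin_topspace)
  qed
  then show ?L
    using f by (auto simp: continuous_map_closedin)
qed

section \<open>Unique lifting and the pushforward of counting measures\<close>

text \<open>The pushforward of \<open>B\<close> counts the edges of the fibre that \<open>m1\<close>
  sends into \<open>B\<close>. Mass 1 at each \<open>{x}\<close> yields a lift of \<open>x\<close>,
  and injectivity makes it unique; conversely, a bijection between the fibres preserves the
  cardinality of every trace.\<close>

lemma counting_measure_distr_iff:
  fixes E :: "('v, 'e) tgraph" and F :: "('w, 'f) tgraph"
  assumes F: "topological_graph F"
    and m1: "continuous_map (edges E) (edges F) m1"
    and rng: "\<And>e. e \<in> rng_fibre E v \<Longrightarrow> m1 e \<in> rng_fibre F w"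
  shows "inj_on m1 (rng_fibre E v) \<and>
      counting_measure F w = distr (counting_measure E v) (Borel_space (edges F)) m1 \<longleftrightarrow>
    (\<forall>x \<in> rng_fibre F w. \<exists>!e. e \<in> rng_fibre E v \<and> m1 e = x)"
    (is "?inj \<and> ?eq \<longleftrightarrow> ?bij")
proof -
  let ?D = "distr (counting_measure E v) (Borel_space (edges F)) m1"
  have sp: "space (counting_measure E v) = topspace (edges E)"
    unfolding counting_measure_def
    by (simp add: sigma_algebra.space_measure_of_eq[OF sigma_algebra_Borel_sets])
  have setsF: "sets (Borel_space (edges F)) = Borel_sets (edges F)"
    unfolding Borel_space_def Borel_sets_def by (rule sets_measure_of) (auto dest: openin_subset)
  have meas: "m1 \<in> measurable (counting_measure E v) (Borel_space (edges F))"
    unfolding Borel_space_def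
  proof (rule measurable_measure_of)
    show "{U. openin (edges F) U} \<subseteq> Pow (topspace (edges F))" by (auto dest: openin_subset)
    show "m1 \<in> space (counting_measure E v) \<rightarrow> topspace (edges F)"
      using m1 by (auto simp: sp continuous_map_def)
    fix U assume "U \<in> {U. openin (edges F) U}"
    then have "openin (edges E) {e \<in> topspace (edges E). m1 e \<in> U}"
      using m1 openin_continuous_map_preimage by blast
    then show "m1 -` U \<inter> space (counting_measure E v) \<in> sets (counting_measure E v)"
      using openin_imp_Borel by (auto simp: sp sets_counting_measure vimage_def Int_def conj_commute)
  qed
  have fibX: "rng_fibre E v \<subseteq> topspace (edges E)" by (auto simp: rng_fibre_def)
  have em: "emeasure ?D B =
      (let A = {e \<in> rng_fibre E v. m1 e \<in> B} in if finite A then of_nat (card A) else \<infinity>)"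
    if B: "B \<in> Borel_sets (edges F)" for B
  proof -
    have "m1 -` B \<inter> topspace (edges E) \<in> Borel_sets (edges E)"
      using measurable_sets[OF meas, of B] B by (simp add: sp sets_counting_measure setsF)
    moreover have "m1 -` B \<inter> topspace (edges E) \<inter> rng_fibre E v = {e \<in> rng_fibre E v. m1 e \<in> B}"
      using fibX by auto
    ultimately show ?thesis
      using emeasure_distr[OF meas, of B] B emeasure_counting_measure[of "m1 -` B \<inter> topspace (edges E)" E v]
      by (simp add: sp setsF Let_def)
  qed
  show ?thesis
  proof
    assume L: "?inj \<and> ?eq"
    show ?bij
    proof
      fix x assume x: "x \<in> rng_fibre F w"
      have B: "{x} \<in> Borel_sets (edges F)"
        using graph_fibre_closed[OF F, of "{x}" w] x closedin_imp_Borel by blast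
      have "{x} \<inter> rng_fibre F w = {x}" using x by blast
      then have "emeasure ?D {x} = 1"
        using emeasure_counting_measure[OF B, of w] L by simp
      \<comment> \<open>Without a lift of \<open>x\<close> the pushforward would give
        \<open>{x}\<close> mass 0 instead of 1.\<close>
      moreover have "emeasure ?D {x} = 0" if "{e \<in> rng_fibre E v. m1 e \<in> {x}} = {}"
        unfolding em[OF B] that by simp
      ultimately have "{e \<in> rng_fibre E v. m1 e \<in> {x}} \<noteq> {}"
        by auto
      then show "\<exists>!e. e \<in> rng_fibre E v \<and> m1 e = x"
        using L by (auto dest: inj_onD)
    qed
  next
    assume R: ?bij
    have inj: ?inj
      using R rng by (intro inj_onI) metis
    have ?eq
    proof (rule measure_eqI)
      show "sets (counting_measure F w) = sets ?D"
        by (simp add: sets_counting_measure setsF)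
      fix B assume "B \<in> sets (counting_measure F w)"
      then have B: "B \<in> Borel_sets (edges F)" by (simp add: sets_counting_measure)
      have "bij_betw m1 {e \<in> rng_fibre E v. m1 e \<in> B} (B \<inter> rng_fibre F w)"
        unfolding bij_betw_def using inj R rng by (auto simp: inj_on_def)
      then show "emeasure (counting_measure F w) B = emeasure ?D B"
        using emeasure_counting_measure[OF B, of w] em[OF B] bij_betw_finite bij_betw_same_card
        by (fastforce simp: Let_def)
    qed
    with inj show "?inj \<and> ?eq" by blast
  qed
qed

section \<open>Regular vertices\<close>

text \<open>A set \<open>V\<close> that witnesses finiteness at \<open>v\<close> does so at every
  point of its interior, so the finite vertices form an open set, from which a closed set is
  removed.\<close>

lemma openin_reg_verts: "openin (verts F) (reg_verts F)"
proof -
  have "openin (verts F) (fin_verts F)"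
  proof (subst openin_subopen, intro ballI)
    fix v assume "v \<in> fin_verts F"
    then obtain V where V: "V \<subseteq> topspace (verts F)" "v \<in> verts F interior_of V"
        "compactin (verts F) (verts F closure_of V)"
        "compactin (edges F) (src_preimage F (verts F closure_of V))"
        "local_homeomorphism (subtopology (edges F) (src_preimage F V)) (verts F) (rng F)"
      by (auto simp: fin_verts_def)
    have "verts F interior_of V \<subseteq> fin_verts F"
    proof
      fix u assume "u \<in> verts F interior_of V"
      then show "u \<in> fin_verts F"
        unfolding fin_verts_def using V(1,3-5) interior_of_subset_topspace[of "verts F" V]
        by (intro CollectI conjI exI[of _ V]) auto
    qed
    then show "\<exists>T. openin (verts F) T \<and> v \<in> T \<and> T \<subseteq> fin_verts F"
      using V(2) openin_interior_of by (intro exI[of _ "verts F interior_of V"] conjI) auto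
  qed
  then show ?thesis unfolding reg_verts_def by (rule openin_diff) (rule closedin_closure_of)
qed

text \<open>
  Near a finite vertex the image of the source map is compact, hence closed, so a vertex outside
  the closure of the sinks actually emits an edge.
\<close>

lemma reg_verts_src_nonempty:
  assumes E: "topological_graph E" and v: "v \<in> reg_verts E"
  shows "src_preimage E {v} \<noteq> {}"
proof -
  obtain V where V: "V \<subseteq> topspace (verts E)" "v \<in> verts E interior_of V"
      "compactin (edges E) (src_preimage E (verts E closure_of V))"
    using v by (auto simp: reg_verts_def fin_verts_def)
  let ?S = "src E ` topspace (edges E)" and ?T = "src E ` src_preimage E (verts E closure_of V)"
  have vX: "v \<in> topspace (verts E)" using v by (auto simp: reg_verts_def fin_verts_def)
  have "sink_verts E \<subseteq> verts E closure_of sink_verts E"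
    by (rule closure_of_subset) (auto simp: sink_verts_def)
  then have vS: "v \<in> verts E closure_of ?S"
    using v vX by (auto simp: reg_verts_def sink_verts_def)
  have "closedin (verts E) ?T"
    using image_compactin[OF V(3) topological_graphD(4)[OF E]] topological_graphD(1)[OF E]
      compactin_imp_closedin by blast
  \<comment> \<open>Neighbourhoods of \<open>v\<close> may be shrunk into the interior of
    \<open>V\<close>; the sources found there come from edges in the compact set
    \<open>src_preimage E (verts E closure_of V)\<close>.\<close>
  moreover have "v \<in> verts E closure_of ?T"
    unfolding in_closure_of
  proof (intro conjI allI impI vX)
    fix U assume U: "v \<in> U \<and> openin (verts E) U"
    then have "openin (verts E) (U \<inter> verts E interior_of V)" "v \<in> U \<inter> verts E interior_of V"
      using V(2) by auto
    then obtain y where y: "y \<in> ?S" "y \<in> U" "y \<in> verts E interior_of V"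
      using vS unfolding in_closure_of by blast
    then have "y \<in> verts E closure_of V"
      using interior_of_subset_closure_of by fast
    then show "\<exists>y. y \<in> ?T \<and> y \<in> U"
      using y by (auto simp: src_preimage_def)
  qed
  ultimately have "v \<in> ?T" by (simp add: closure_of_closedin)
  then show ?thesis by (auto simp: src_preimage_def)
qed

text \<open>Properness of \<open>m0\<close> and \<open>m1\<close> transports the two compactness
  conditions from a neighbourhood of \<open>m0 v\<close> to its preimage, and the range map of a
  graph is a local homeomorphism on every open set of edges. Sinks stay away from \<open>v\<close>
  because all vertices over the open set \<open>reg_verts F\<close> emit edges.\<close>

lemma reg_verts_preimage:
  fixes E :: "('v, 'e) tgraph" and F :: "('w, 'f) tgraph"
  assumes E: "topological_graph E" and F: "topological_graph F"
    and m1: "continuous_map (edges E) (edges F) m1" "compact_preimages (edges E) (edges F) m1"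
    and m0: "continuous_map (verts E) (verts F) m0" "compact_preimages (verts E) (verts F) m0"
    and src: "\<And>e. e \<in> topspace (edges E) \<Longrightarrow> src F (m1 e) = m0 (src E e)"
    and ne: "\<And>v. \<lbrakk>v \<in> topspace (verts E); m0 v \<in> reg_verts F\<rbrakk> \<Longrightarrow> src_preimage E {v} \<noteq> {}"
    and v: "v \<in> topspace (verts E)" "m0 v \<in> reg_verts F"
  shows "v \<in> reg_verts E"
proof -
  obtain W where W: "W \<subseteq> topspace (verts F)" "m0 v \<in> verts F interior_of W"
      "compactin (verts F) (verts F closure_of W)"
      "compactin (edges F) (src_preimage F (verts F closure_of W))"
    using v(2) by (auto simp: reg_verts_def fin_verts_def)
  \<comment> \<open>The interior of \<open>W\<close> is pulled back, not \<open>W\<close> itself, so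
    that \<open>V\<close> is open and the range map can be restricted to the edges it emits. The
    closed set \<open>C\<close> bounds the closure of \<open>V\<close>.\<close>
  define V where "V = {u \<in> topspace (verts E). m0 u \<in> verts F interior_of W}"
  define C where "C = {u \<in> topspace (verts E). m0 u \<in> verts F closure_of W}"
  have openV: "openin (verts E) V"
    unfolding V_def using m0(1) openin_continuous_map_preimage openin_interior_of by blast
  have closedC: "closedin (verts E) C"
    unfolding C_def using m0(1) closedin_continuous_map_preimage closedin_closure_of by blast
  have VC: "verts E closure_of V \<subseteq> C"
    using interior_of_subset_closure_of[of "verts F" W]
    by (intro closure_of_minimal[OF _ closedC]) (auto simp: V_def C_def)
  have "compactin (verts E) C"
    unfolding C_def using m0(2) W(3) by (simp add: compact_preimages_def)
  then have cV: "compactin (verts E) (verts E closure_of V)"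
    using VC closed_compactin closedin_closure_of by blast
  have "compactin (edges E) {e \<in> topspace (edges E). m1 e \<in> src_preimage F (verts F closure_of W)}"
    using m1(2) W(4) by (simp add: compact_preimages_def)
  moreover have "src_preimage E (verts E closure_of V) \<subseteq>
      {e \<in> topspace (edges E). m1 e \<in> src_preimage F (verts F closure_of W)}"
    using VC m1(1) src by (auto simp: src_preimage_def C_def continuous_map_def)
  moreover have "closedin (edges E) (src_preimage E (verts E closure_of V))"
    unfolding src_preimage_def
    using topological_graphD(4)[OF E] closedin_continuous_map_preimage closedin_closure_of by blast
  ultimately have csV: "compactin (edges E) (src_preimage E (verts E closure_of V))"
    using closed_compactin by blast
  have "openin (edges E) (src_preimage E V)"
    unfolding src_preimage_def
    using topological_graphD(4)[OF E] openV openin_continuous_map_preimage by blast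
  then have "local_homeomorphism (subtopology (edges E) (src_preimage E V)) (verts E) (rng E)"
    using local_homeomorphism_open_subtopology topological_graphD(3)[OF E] by blast
  moreover have "v \<in> verts E interior_of V"
    using openV v W(2) by (simp add: interior_of_openin V_def)
  ultimately have fin: "v \<in> fin_verts E"
    unfolding fin_verts_def using v cV csV openin_subset[OF openV] by blast
  \<comment> \<open>An open set that misses the sinks also misses their closure; \<open>R\<close> is
    such a set around \<open>v\<close>.\<close>
  define R where "R = {u \<in> topspace (verts E). m0 u \<in> reg_verts F}"
  have "openin (verts E) R"
    unfolding R_def using m0(1) openin_reg_verts openin_continuous_map_preimage by blast
  moreover have "R \<inter> sink_verts E = {}"
  proof -
    have "u \<in> verts E closure_of (src E ` topspace (edges E))" if "u \<in> R" for u
    proof -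
      have "u \<in> src E ` topspace (edges E)"
        using that ne by (fastforce simp: R_def src_preimage_def)
      moreover have "src E ` topspace (edges E) \<subseteq> topspace (verts E)"
        using topological_graphD(4)[OF E] by (auto simp: continuous_map_def)
      ultimately show ?thesis using closure_of_subset by fast
    qed
    then show ?thesis by (auto simp: sink_verts_def)
  qed
  ultimately have "R \<inter> verts E closure_of sink_verts E = {}"
    by (simp add: openin_Int_closure_of_eq_empty)
  then have "v \<notin> verts E closure_of sink_verts E"
    using v by (auto simp: R_def)
  with fin show ?thesis by (simp add: reg_verts_def)
qed

section \<open>The equivalence\<close>

theorem proposition3p7:
  fixes E :: "('v, 'e) tgraph" and F :: "('w, 'f) tgraph"
    and m1 :: "'e \<Rightarrow> 'f" and m0 :: "'v \<Rightarrow> 'w"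
  assumes "topological_graph E" and "topological_graph F"
    and "m1 \<in> topspace (edges E) \<rightarrow> topspace (edges F)"
    and "m0 \<in> topspace (verts E) \<rightarrow> topspace (verts F)"
  shows "regular_factor_map E F (map_option m1) (map_option m0) \<longleftrightarrow>
         regular_quiver_morphism (counting_quiver E) (counting_quiver F) m1 m0"
proof -
  have sel: "verts (counting_quiver G) = verts G" "edges (counting_quiver G) = edges G"
    "src (counting_quiver G) = src G" "rng (counting_quiver G) = rng G"
    "fib_measure (counting_quiver G) = counting_measure G"
    "rng_fibre (counting_quiver G) = rng_fibre G"
    "reg_verts (counting_quiver G) = reg_verts G" for G :: "('x, 'y) tgraph"
    by (simp_all add: counting_quiver_def rng_fibre_def fun_eq_iff reg_verts_def fin_verts_def
        sink_verts_def src_preimage_def)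
  note ext = continuous_map_Alexandroff_compactification_iff[OF topological_graphD(2)[OF assms(2)] assms(3)]
    continuous_map_Alexandroff_compactification_iff[OF topological_graphD(1)[OF assms(2)] assms(4)]
  \<comment> \<open>Both notions are split into comparable conditions: \<open>cont\<close> and
    \<open>comm\<close> are common to the two sides, \<open>lift\<close> is to match
    \<open>meas\<close>, and \<open>nonempty\<close> is to match \<open>reg\<close>.\<close>
  define cont where "cont \<longleftrightarrow>
    continuous_map (edges E) (edges F) m1 \<and> compact_preimages (edges E) (edges F) m1 \<and>
    continuous_map (verts E) (verts F) m0 \<and> compact_preimages (verts E) (verts F) m0"
  define comm where "comm \<longleftrightarrow> (\<forall>e \<in> topspace (edges E).
    src F (m1 e) = m0 (src E e) \<and> rng F (m1 e) = m0 (rng E e))"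
  define lift where "lift \<longleftrightarrow> (\<forall>v \<in> topspace (verts E). \<forall>x \<in> rng_fibre F (m0 v).
    \<exists>!e. e \<in> rng_fibre E v \<and> m1 e = x)"
  define meas where "meas \<longleftrightarrow> (\<forall>v \<in> topspace (verts E). inj_on m1 (rng_fibre E v) \<and>
    counting_measure F (m0 v) = distr (counting_measure E v) (Borel_space (edges F)) m1)"
  define nonempty where "nonempty \<longleftrightarrow> (\<forall>v \<in> topspace (verts E). m0 v \<in> reg_verts F \<longrightarrow>
    src_preimage E {v} \<noteq> {})"
  define reg where "reg \<longleftrightarrow> {v \<in> topspace (verts E). m0 v \<in> reg_verts F} \<subseteq> reg_verts E"
  have m1: "m1 e \<in> topspace (edges F)" if "e \<in> topspace (edges E)" for e
    using that assms(3) by blast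
  \<comment> \<open>No edge or vertex is sent to infinity, so (F1) concerns all edges and becomes
    \<open>comm\<close>, while (F2), grouped by the vertex \<open>v\<close>, becomes
    \<open>lift\<close>.\<close>
  have "factor_map E F (map_option m1) (map_option m0) \<longleftrightarrow> cont \<and> comm \<and> lift"
    unfolding factor_map_def ext cont_def comm_def lift_def rng_fibre_def
    using assms(1,2) m1 by (simp add: conj_ac) blast
  \<comment> \<open>For the same reason the containment half of regularity holds automatically,
    which leaves only \<open>nonempty\<close>.\<close>
  moreover have "m1 ` src_preimage E A \<subseteq> topspace (edges F)" for A
    using m1 by (auto simp: src_preimage_def)
  ultimately have 1: "regular_factor_map E F (map_option m1) (map_option m0) \<longleftrightarrow>
      cont \<and> comm \<and> lift \<and> nonempty"
    unfolding regular_factor_map_def nonempty_def by (auto simp: image_iff)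
  have 2: "regular_quiver_morphism (counting_quiver E) (counting_quiver F) m1 m0 \<longleftrightarrow>
      cont \<and> comm \<and> meas \<and> reg"
    unfolding regular_quiver_morphism_def quiver_morphism_def sel cont_def comm_def meas_def reg_def
    by (simp only: assms(1,2)[THEN topological_quiver_counting_quiver] simp_thms conj_ac)
  \<comment> \<open>\<open>comm\<close> places the image of each range fibre inside a range fibre,
    so the comparison can be made one vertex at a time.\<close>
  have 3: "lift \<longleftrightarrow> meas" if "cont" "comm"
  proof -
    have fib: "m1 e \<in> rng_fibre F (m0 v)" if "e \<in> rng_fibre E v" for e v
      using that m1 \<open>comm\<close> by (auto simp: comm_def rng_fibre_def)
    have "continuous_map (edges E) (edges F) m1"
      using \<open>cont\<close> by (simp add: cont_def)
    from counting_measure_distr_iff[OF assms(2) this fib] show ?thesis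
      unfolding lift_def meas_def by simp
  qed
  have 4: "nonempty \<longleftrightarrow> reg" if "cont" "comm"
    unfolding nonempty_def reg_def
    using that reg_verts_preimage[OF assms(1,2), of m1 m0] reg_verts_src_nonempty[OF assms(1)]
    unfolding cont_def comm_def by blast
  show ?thesis unfolding 1 2 using 3 4 by blast
qed

end
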